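(* For each real $r\neq 0,1$, each $s>0$ and each $\epsilon>0$, there exist an invertible matrix $K\in\mathcal{I}_2$ and a positive definite matrix $M\in\mathcal{P}_2$ satisfying $\|M-I\|<\epsilon$ such that the function $\Lambda_{r,s}(\cdot)[K,M]$ (as a function of $A\in\mathcal{P}_2$) is neither concave nor convex. In fact, $K$ and $M$ can be chosen as \[ K=\begin{pmatrix}1&0\\0&k\end{pmatrix},\qquad M=\begin{pmatrix}1&t\\t&1\end{pmatrix} \] for suitably small positive $k$ and any choice of $|t|<\epsilon$.
   Context: $\mathcal{M}_n$ is the set of complex $n\times n$ matrices, $\mathcal{P}_n\subseteq\mathcal{M}_n$ the subset of positive definite matrices, and $\mathcal{I}_n\subseteq\mathcal{M}_n$ the subset of invertible matrices. $\|\cdot\|$ is the operator norm and $I$ is the identity matrix. For $r,s\in\mathbb{R}$, $A,M\in\mathcal{P}_n$ and $K\in\mathcal{I}_n$, define \[ \Lambda_{r,s}(A)[K,M]:=\operatorname{tr}\left[\left(K^*A^rMA^rK\right)^s\right], \] where real powers of positive definite matrices are taken via the functional calculus.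
   Formalization: The choice of t is restricted to 0 < |t| < min(ε, 1): for t = 0 the claim fails (r = 1/2, s = 1 gives the linear function tr(K*AK)), and for |t| ≥ 1 the matrix M is not positive definite; "suitably small k" may depend on t. *)

theory Defs
  imports "HOL-Analysis.Analysis"
begin

definition conj_transpose :: "complex ^ 'n ^ 'm \<Rightarrow> complex ^ 'm ^ 'n" where
  "conj_transpose A = (\<chi> i j. cnj (A $ j $ i))"

definition unitary_matrix :: "complex ^ 'n ^ 'n \<Rightarrow> bool" where
  "unitary_matrix U \<longleftrightarrow>
     conj_transpose U ** U = mat 1 \<and> U ** conj_transpose U = mat 1"

definition real_diag :: "('n \<Rightarrow> real) \<Rightarrow> complex ^ 'n ^ 'n" where
  "real_diag d = (\<chi> i j. if i = j then complex_of_real (d i) else 0)"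

text \<open>For Hermitian \<open>A\<close> the sum below, which is \<open>v\<^sup>* A v\<close>, is real.\<close>

definition posdef :: "complex ^ 'n ^ 'n \<Rightarrow> bool" where
  "posdef A \<longleftrightarrow> conj_transpose A = A \<and>
     (\<forall>v. v \<noteq> 0 \<longrightarrow> Re (\<Sum>i\<in>UNIV. cnj (v $ i) * (A *v v) $ i) > 0)"

text \<open>Functional calculus of a Hermitian matrix. The matrix \<open>B\<close> does not depend on the
  chosen unitary diagonalisation of \<open>A\<close>: see \<open>matrix_fun_eqI\<close> below. For non-Hermitian
  arguments the value is unspecified.\<close>

definition matrix_fun :: "(real \<Rightarrow> real) \<Rightarrow> complex ^ 'n ^ 'n \<Rightarrow> complex ^ 'n ^ 'n" where
  "matrix_fun f A = (THE B. \<exists>U d. unitary_matrix U \<and>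
     A = U ** real_diag d ** conj_transpose U \<and>
     B = U ** real_diag (\<lambda>i. f (d i)) ** conj_transpose U)"

definition matrix_powr :: "complex ^ 'n ^ 'n \<Rightarrow> real \<Rightarrow> complex ^ 'n ^ 'n" where
  "matrix_powr A p = matrix_fun (\<lambda>x. x powr p) A"

text \<open>The norm on \<open>complex ^ 'n\<close> is the Euclidean one, so this is the operator norm; the
  library's \<open>norm\<close> on matrices is the Frobenius norm.\<close>

definition op_norm :: "complex ^ 'n ^ 'n \<Rightarrow> real" where
  "op_norm A = onorm (\<lambda>v. A *v v)"

text \<open>For positive definite \<open>A\<close>, \<open>M\<close> and invertible \<open>K\<close> the \<open>s\<close>-th power is taken of a
  positive definite matrix, so the trace is a real number and \<open>Re\<close> is only a coercion.\<close>

definition Lambda :: "real \<Rightarrow> real \<Rightarrow> complex ^ 'n ^ 'n \<Rightarrow> complex ^ 'n ^ 'n \<Rightarrow>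
    complex ^ 'n ^ 'n \<Rightarrow> real" where
  "Lambda r s K M A = Re (trace (matrix_powr
     (conj_transpose K ** matrix_powr A r ** M ** matrix_powr A r ** K) s))"

lemma real_diag_mult_left: "(real_diag d ** A) $ i $ j = complex_of_real (d i) * A $ i $ j"
  by (simp add: real_diag_def matrix_matrix_mult_def if_distrib if_distribR cong: if_cong)

lemma real_diag_mult_right: "(A ** real_diag d) $ i $ j = A $ i $ j * complex_of_real (d j)"
  by (simp add: real_diag_def matrix_matrix_mult_def if_distrib if_distribR cong: if_cong)

lemma diagonalisation_unique:
  fixes U V :: "complex ^ 'n ^ 'n"
  assumes U: "unitary_matrix U" and V: "unitary_matrix V"
    and eq: "U ** real_diag d ** conj_transpose U = V ** real_diag e ** conj_transpose V"
  shows "U ** real_diag (\<lambda>i. f (d i)) ** conj_transpose U =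
         V ** real_diag (\<lambda>i. f (e i)) ** conj_transpose V"
proof -
  define W where "W = conj_transpose V ** U"
  have UU: "conj_transpose U ** U = mat 1" "U ** conj_transpose U = mat 1"
    and VV: "conj_transpose V ** V = mat 1" "V ** conj_transpose V = mat 1"
    using U V by (auto simp: unitary_matrix_def)
  have "conj_transpose V ** (U ** real_diag d ** conj_transpose U) ** U = W ** real_diag d"
  proof -
    have "conj_transpose V ** (U ** real_diag d ** conj_transpose U) ** U
        = W ** real_diag d ** (conj_transpose U ** U)"
      by (simp only: W_def matrix_mul_assoc)
    then show ?thesis by (simp add: UU(1))
  qed
  moreover have "conj_transpose V ** (V ** real_diag e ** conj_transpose V) ** U
      = real_diag e ** W"
  proof -
    have "conj_transpose V ** (V ** real_diag e ** conj_transpose V) ** U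
        = (conj_transpose V ** V) ** real_diag e ** W"
      by (simp only: W_def matrix_mul_assoc)
    then show ?thesis by (simp add: VV(1))
  qed
  ultimately have WD: "W ** real_diag d = real_diag e ** W"
    using eq by simp
  have "W ** real_diag (\<lambda>i. f (d i)) = real_diag (\<lambda>i. f (e i)) ** W"
  proof -
    have "W $ i $ j * complex_of_real (f (d j)) = complex_of_real (f (e i)) * W $ i $ j" for i j
    proof -
      have "W $ i $ j * complex_of_real (d j) = complex_of_real (e i) * W $ i $ j"
        using arg_cong[OF WD, of "\<lambda>C. C $ i $ j"]
        by (simp only: real_diag_mult_left real_diag_mult_right)
      then have "W $ i $ j = 0 \<or> d j = e i"
        by (simp add: mult.commute)
      then show ?thesis
        by (auto simp: mult.commute)
    qed
    then show ?thesis
      by (simp add: vec_eq_iff real_diag_mult_left real_diag_mult_right)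
  qed
  then have "V ** (W ** real_diag (\<lambda>i. f (d i))) ** conj_transpose U =
      V ** (real_diag (\<lambda>i. f (e i)) ** W) ** conj_transpose U"
    by simp
  moreover have "V ** W = U"
    by (simp add: W_def matrix_mul_assoc VV(2))
  moreover have "W ** conj_transpose U = conj_transpose V"
    by (simp add: W_def matrix_mul_assoc[symmetric] UU(2))
  ultimately show ?thesis
    by (simp add: matrix_mul_assoc[symmetric]) (simp add: matrix_mul_assoc)
qed

lemma matrix_fun_eqI:
  assumes "unitary_matrix U"
  shows "matrix_fun f (U ** real_diag d ** conj_transpose U) =
         U ** real_diag (\<lambda>i. f (d i)) ** conj_transpose U"
  unfolding matrix_fun_def
proof (rule the_equality)
  show "\<exists>V e. unitary_matrix V \<and>
      U ** real_diag d ** conj_transpose U = V ** real_diag e ** conj_transpose V \<and>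
      U ** real_diag (\<lambda>i. f (d i)) ** conj_transpose U =
      V ** real_diag (\<lambda>i. f (e i)) ** conj_transpose V"
    using assms by blast
next
  fix B
  assume "\<exists>V e. unitary_matrix V \<and>
      U ** real_diag d ** conj_transpose U = V ** real_diag e ** conj_transpose V \<and>
      B = V ** real_diag (\<lambda>i. f (e i)) ** conj_transpose V"
  then show "B = U ** real_diag (\<lambda>i. f (d i)) ** conj_transpose U"
    using diagonalisation_unique[OF assms] by metis
qed

text \<open>The library's \<open>convex_on S\<close> and \<open>concave_on S\<close> include \<open>convex S\<close>; hence their
  negations speak about the function only because of the following fact.\<close>

lemma convex_posdef: "convex {A :: complex ^ 'n ^ 'n. posdef A}"
proof (rule convexI)
  fix A B :: "complex ^ 'n ^ 'n" and u v :: real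
  assume A: "A \<in> {A. posdef A}" and B: "B \<in> {A. posdef A}"
    and uv: "0 \<le> u" "0 \<le> v" "u + v = 1"
  let ?q = "\<lambda>(C :: complex ^ 'n ^ 'n) x. Re (\<Sum>i\<in>UNIV. cnj (x $ i) * (C *v x) $ i)"
  have q: "?q (u *\<^sub>R A + v *\<^sub>R B) x = u * ?q A x + v * ?q B x" for x
  proof -
    have "((u *\<^sub>R A + v *\<^sub>R B) *v x) $ i = u *\<^sub>R (A *v x) $ i + v *\<^sub>R (B *v x) $ i" for i
      by (simp add: matrix_vector_mult_def algebra_simps sum.distrib scaleR_sum_right)
    then have "(\<Sum>i\<in>UNIV. cnj (x $ i) * ((u *\<^sub>R A + v *\<^sub>R B) *v x) $ i) =
        u *\<^sub>R (\<Sum>i\<in>UNIV. cnj (x $ i) * (A *v x) $ i) + v *\<^sub>R (\<Sum>i\<in>UNIV. cnj (x $ i) * (B *v x) $ i)"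
      by (simp add: distrib_left sum.distrib scaleR_sum_right)
    then show ?thesis by simp
  qed
  have pos: "?q (u *\<^sub>R A + v *\<^sub>R B) x > 0" if "x \<noteq> 0" for x
  proof -
    have "?q A x > 0" "?q B x > 0"
      using A B that by (auto simp: posdef_def simp del: Re_sum)
    then show ?thesis
      unfolding q using uv
      by (cases "u = 0") (auto intro!: add_pos_nonneg simp del: Re_sum)
  qed
  have herm: "conj_transpose (u *\<^sub>R A + v *\<^sub>R B) = u *\<^sub>R A + v *\<^sub>R B"
    using A B by (simp add: posdef_def conj_transpose_def vec_eq_iff)
  show "u *\<^sub>R A + v *\<^sub>R B \<in> {A. posdef A}"
    using herm pos unfolding posdef_def by blast
qed

end

theory Submission
  imports Defs
begin

text \<open>Fix \<open>t\<close> and let \<open>k \<rightarrow> 0\<close>: with \<open>u = A\<^sup>r e\<^sub>1\<close>, the function converges pointwise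
  to \<open>F(A) = \<langle>u, M u\<rangle>\<^sup>s\<close>. A strict violation of the convexity or concavity inequality by \<open>F\<close>
  at finitely many points survives for all small \<open>k\<close>, so it suffices to study \<open>F\<close>. For
  \<open>A\<close> with diagonal \<open>(1, b)\<close> and off-diagonal entry \<open>h\<close>, write \<open>F(b, h)\<close>. Then
  \<open>F(b, 0) = 1\<close> for all \<open>b\<close>, while \<open>\<partial>F/\<partial>h (b, 0) = 2 t s (1 - b\<^sup>r) / (1 - b)\<close> takes
  different values at \<open>b = 1/4\<close> and \<open>b = 1/2\<close> because \<open>r \<noteq> 0, 1\<close>. Hence
  \<open>F(1/4, x) + F(1/2, -x) - 2 F(3/8, 0)\<close> vanishes at \<open>x = 0\<close> with nonzero derivative and
  takes both signs near \<open>0\<close>, although \<open>(3/8, 0)\<close> is the midpoint of the two points.\<close>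

section \<open>Real symmetric two-by-two matrices\<close>

definition sym2 :: "real \<Rightarrow> real \<Rightarrow> real \<Rightarrow> complex ^ 2 ^ 2" where
  "sym2 a h b = vector [vector [complex_of_real a, complex_of_real h],
                        vector [complex_of_real h, complex_of_real b]]"

lemma sym2_nth [simp]:
  "sym2 a h b $ 1 $ 1 = of_real a" "sym2 a h b $ 1 $ 2 = of_real h"
  "sym2 a h b $ 2 $ 1 = of_real h" "sym2 a h b $ 2 $ 2 = of_real b"
  by (simp_all add: sym2_def)

lemma conj_transpose_sym2 [simp]: "conj_transpose (sym2 a h b) = sym2 a h b"
  by (simp add: conj_transpose_def vec_eq_iff forall_2)

lemma trace_sym2: "trace (sym2 a h b) = of_real (a + b)"
  by (simp add: trace_def sum_2)

lemma invertible_sym2: "a * b \<noteq> h * h \<Longrightarrow> invertible (sym2 a h b)"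
  by (simp add: invertible_det_nz det_2 flip: of_real_mult of_real_diff)

lemma posdef_sym2:
  assumes "a > 0" and det: "h\<^sup>2 < a * b"
  shows "posdef (sym2 a h b)"
proof -
  have "Re (\<Sum>i\<in>UNIV. cnj (v $ i) * (sym2 a h b *v v) $ i) > 0" (is "?Q > 0")
    if "v \<noteq> 0" for v :: "complex ^ 2"
  proof -
    obtain x y where x: "v $ 1 = Complex x y"
      by (metis complex.exhaust)
    obtain z w where z: "v $ 2 = Complex z w"
      by (metis complex.exhaust)
    have nz: "x \<noteq> 0 \<or> y \<noteq> 0 \<or> z \<noteq> 0 \<or> w \<noteq> 0"
      using that x z by (auto simp: vec_eq_iff forall_2 complex_eq_iff)
    \<comment> \<open>Multiplying by \<open>a\<close> allows completing the square; the determinant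
      is the coefficient of what remains.\<close>
    have Q: "a * ?Q = (a * x + h * z)\<^sup>2 + (a * y + h * w)\<^sup>2 + (a * b - h\<^sup>2) * (z\<^sup>2 + w\<^sup>2)"
      by (simp add: sum_2 matrix_vector_mult_def x z algebra_simps power2_eq_square)
    have "a * ?Q > 0"
    proof (cases "z = 0 \<and> w = 0")
      case True
      then have "x\<^sup>2 + y\<^sup>2 > 0"
        using nz by (simp add: sum_power2_gt_zero_iff)
      then have "a\<^sup>2 * (x\<^sup>2 + y\<^sup>2) > 0"
        using \<open>a > 0\<close> by simp
      then show ?thesis
        unfolding Q using True by (simp add: algebra_simps power2_eq_square)
    next
      case False
      then have "(a * b - h\<^sup>2) * (z\<^sup>2 + w\<^sup>2) > 0"
        using det by (simp add: sum_power2_gt_zero_iff)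
      then show ?thesis
        unfolding Q by (intro add_nonneg_pos) simp_all
    qed
    then show ?thesis
      using \<open>a > 0\<close> by (simp only: zero_less_mult_pos)
  qed
  then show ?thesis
    unfolding posdef_def using conj_transpose_sym2 by blast
qed

lemma op_norm_off_diagonal: "op_norm (sym2 1 t 1 - mat 1) \<le> \<bar>t\<bar>"
  unfolding op_norm_def
proof (rule onorm_le)
  fix v :: "complex ^ 2"
  have "(sym2 1 t 1 - mat 1) *v v = vector [of_real t * v $ 2, of_real t * v $ 1]"
    by (simp add: vec_eq_iff forall_2 matrix_vector_mult_def sum_2 mat_def)
  then show "norm ((sym2 1 t 1 - mat 1) *v v) \<le> \<bar>t\<bar> * norm v"
    by (simp add: norm_vec_def L2_set_def sum_2 norm_mult power_mult_distrib add.commute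
        real_sqrt_mult flip: distrib_left)
qed

section \<open>Functional calculus in closed form\<close>

text \<open>The eigenvalues of \<open>sym2 a h b\<close> are \<open>(a + b) / 2 \<plusminus> gap2 a h b\<close>. When the gap
  vanishes, \<open>slope2\<close> is \<open>0 / 0 = 0\<close>, which is the right value for scalar matrices.\<close>

definition gap2 :: "real \<Rightarrow> real \<Rightarrow> real \<Rightarrow> real" where
  "gap2 a h b = sqrt (((a - b) / 2)\<^sup>2 + h\<^sup>2)"

definition mean2 :: "(real \<Rightarrow> real) \<Rightarrow> real \<Rightarrow> real \<Rightarrow> real \<Rightarrow> real" where
  "mean2 f a h b = (f ((a + b) / 2 + gap2 a h b) + f ((a + b) / 2 - gap2 a h b)) / 2"

definition slope2 :: "(real \<Rightarrow> real) \<Rightarrow> real \<Rightarrow> real \<Rightarrow> real \<Rightarrow> real" where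
  "slope2 f a h b =
     (f ((a + b) / 2 + gap2 a h b) - f ((a + b) / 2 - gap2 a h b)) / (2 * gap2 a h b)"

text \<open>In the double angle, half the diagonal difference and the off-diagonal entry are the
  Cartesian coordinates of the point with polar coordinates \<open>(d 1 - d 2) / 2\<close> and
  \<open>2 * \<theta>\<close>. A real symmetric matrix can thus be diagonalised by reading off polar
  coordinates.\<close>

lemma rotation_conjugate:
  fixes \<theta> :: real
  defines "U \<equiv> vector [vector [of_real (cos \<theta>), - of_real (sin \<theta>)],
                       vector [of_real (sin \<theta>), of_real (cos \<theta>)]] :: complex ^ 2 ^ 2"
  shows "unitary_matrix U"
    and "U ** real_diag d ** conj_transpose U =
         sym2 ((d 1 + d 2) / 2 + (d 1 - d 2) / 2 * cos (2 * \<theta>)) ((d 1 - d 2) / 2 * sin (2 * \<theta>))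
              ((d 1 + d 2) / 2 - (d 1 - d 2) / 2 * cos (2 * \<theta>))"
proof -
  have sc: "cos \<theta> * cos \<theta> + sin \<theta> * sin \<theta> = 1"
    using sin_cos_squared_add2[of \<theta>] by (simp add: power2_eq_square)
  show "unitary_matrix U"
    using sc by (simp add: unitary_matrix_def U_def vec_eq_iff forall_2 matrix_matrix_mult_def sum_2
        conj_transpose_def mat_def algebra_simps flip: of_real_mult of_real_add)
  have c': "(cos \<theta>)\<^sup>2 = 1 - (sin \<theta>)\<^sup>2"
    by (rule cos_squared_eq)
  have c: "cos (2 * \<theta>) = 1 - 2 * (sin \<theta>)\<^sup>2"
    by (simp add: cos_double c')
  have s: "sin (2 * \<theta>) = 2 * sin \<theta> * cos \<theta>"
    by (rule sin_double)
  have e: "cos \<theta> * d 1 * cos \<theta> + sin \<theta> * d 2 * sin \<theta> = d 1 * (cos \<theta>)\<^sup>2 + d 2 * (sin \<theta>)\<^sup>2"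
    "sin \<theta> * d 1 * sin \<theta> + cos \<theta> * d 2 * cos \<theta> = d 1 * (sin \<theta>)\<^sup>2 + d 2 * (cos \<theta>)\<^sup>2"
    by (simp_all add: power2_eq_square)
  have "cos \<theta> * d 1 * cos \<theta> + sin \<theta> * d 2 * sin \<theta>
      = (d 1 + d 2) / 2 + (d 1 - d 2) / 2 * cos (2 * \<theta>)"
    "cos \<theta> * d 1 * sin \<theta> - sin \<theta> * d 2 * cos \<theta> = (d 1 - d 2) / 2 * sin (2 * \<theta>)"
    "sin \<theta> * d 1 * cos \<theta> - cos \<theta> * d 2 * sin \<theta> = (d 1 - d 2) / 2 * sin (2 * \<theta>)"
    "sin \<theta> * d 1 * sin \<theta> + cos \<theta> * d 2 * cos \<theta>
      = (d 1 + d 2) / 2 - (d 1 - d 2) / 2 * cos (2 * \<theta>)"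
    unfolding e c c' s by (simp_all add: field_simps)
  note this[symmetric]
  then show "U ** real_diag d ** conj_transpose U =
         sym2 ((d 1 + d 2) / 2 + (d 1 - d 2) / 2 * cos (2 * \<theta>)) ((d 1 - d 2) / 2 * sin (2 * \<theta>))
              ((d 1 + d 2) / 2 - (d 1 - d 2) / 2 * cos (2 * \<theta>))"
    by (simp only: vec_eq_iff forall_2 sym2_nth)
       (simp add: U_def matrix_matrix_mult_def sum_2 conj_transpose_def real_diag_def)
qed

text \<open>\<open>f\<close> of the matrix is the affine interpolant of \<open>f\<close> at the two
  eigenvalues, evaluated at the matrix: \<open>mean2\<close> times the identity plus
  \<open>slope2\<close> times the traceless part.\<close>

lemma matrix_fun_sym2:
  "matrix_fun f (sym2 a h b) =
     sym2 (mean2 f a h b + slope2 f a h b * (a - b) / 2) (slope2 f a h b * h)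
          (mean2 f a h b - slope2 f a h b * (a - b) / 2)"
proof -
  let ?g = "gap2 a h b"
  define z where "z = Complex ((a - b) / 2) h"
  \<comment> \<open>Conjugation by a rotation doubles its angle, hence the half. If
    \<open>z = 0\<close>, the matrix is scalar and every angle works.\<close>
  define \<theta> where "\<theta> = Arg z / 2"
  have nz: "cmod z = ?g"
    by (simp add: z_def gap2_def complex_norm)
  have "z = of_real ?g * cis (2 * \<theta>)"
    using rcis_cmod_Arg[of z] by (simp add: \<theta>_def nz rcis_def)
  then have co: "?g * cos (2 * \<theta>) = (a - b) / 2" and si: "?g * sin (2 * \<theta>) = h"
    by (simp_all add: z_def complex_eq_iff)
  define d where "d i = (if i = 1 then (a + b) / 2 + ?g else (a + b) / 2 - ?g)" for i :: 2
  define U where "U = (vector [vector [of_real (cos \<theta>), - of_real (sin \<theta>)],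
                       vector [of_real (sin \<theta>), of_real (cos \<theta>)]] :: complex ^ 2 ^ 2)"
  have d12: "(d 1 + d 2) / 2 = (a + b) / 2" "(d 1 - d 2) / 2 = ?g"
    by (simp_all add: d_def)
  have A: "U ** real_diag d ** conj_transpose U = sym2 a h b"
    unfolding U_def rotation_conjugate d12 co si by (simp add: field_simps)
  have S: "(f ((a + b) / 2 + ?g) - f ((a + b) / 2 - ?g)) / 2 = slope2 f a h b * ?g"
    by (cases "?g = 0") (simp_all add: slope2_def)
  have "matrix_fun f (sym2 a h b) = U ** real_diag (\<lambda>i. f (d i)) ** conj_transpose U"
    unfolding A[symmetric] by (rule matrix_fun_eqI) (simp add: U_def rotation_conjugate)
  also have "\<dots> = sym2 (mean2 f a h b + slope2 f a h b * (?g * cos (2 * \<theta>)))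
      (slope2 f a h b * (?g * sin (2 * \<theta>)))
      (mean2 f a h b - slope2 f a h b * (?g * cos (2 * \<theta>)))"
    unfolding U_def rotation_conjugate
    by (simp add: d_def S mean2_def mult.assoc)
  finally show ?thesis
    by (simp add: co si)
qed

section \<open>The limit as k tends to 0\<close>

text \<open>Here \<open>(u, v)\<close> is the first column of the \<open>r\<close>-th power of \<open>sym2 a h b\<close>.\<close>

definition corner :: "real \<Rightarrow> real \<Rightarrow> real \<Rightarrow> real \<Rightarrow> real \<Rightarrow> real" where
  "corner r t a h b = (let f = (\<lambda>x. x powr r);
      u = mean2 f a h b + slope2 f a h b * (a - b) / 2; v = slope2 f a h b * h
    in u\<^sup>2 + 2 * t * u * v + v\<^sup>2)"

text \<open>The entries carry the factors 1, \<open>k\<close> and \<open>k\<^sup>2\<close>, so the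
  product degenerates to rank one as \<open>k\<close> tends to 0. Without these factors they form
  the Gram matrix of the columns \<open>(p, q)\<close> and \<open>(q, w)\<close> in the form given
  by \<open>sym2 1 t 1\<close>.\<close>

lemma sym2_sandwich:
  "sym2 1 0 k ** sym2 p q w ** sym2 1 t 1 ** sym2 p q w ** sym2 1 0 k =
   sym2 (p\<^sup>2 + 2 * t * p * q + q\<^sup>2) (k * (p * q + t * (p * w + q\<^sup>2) + q * w))
        (k\<^sup>2 * (q\<^sup>2 + 2 * t * q * w + w\<^sup>2))"
  by (simp add: vec_eq_iff forall_2 matrix_matrix_mult_def sum_2 algebra_simps power2_eq_square)

text \<open>Twice \<open>mean2\<close> is the trace of the \<open>s\<close>-th power. The two
  eigenvalues tend to \<open>C\<close> and 0, and \<open>s > 0\<close> makes the second contribution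
  vanish.\<close>

lemma tendsto_mean2_rank_one:
  assumes "s > 0" and C: "C \<ge> 0" and "E \<ge> 0" and det: "D\<^sup>2 \<le> C * E"
  shows "((\<lambda>k. 2 * mean2 (\<lambda>x. x powr s) C (k * D) (k\<^sup>2 * E)) \<longlongrightarrow> C powr s) (at_right 0)"
proof -
  let ?m = "\<lambda>k. (C + k\<^sup>2 * E) / 2" and ?g = "\<lambda>k. gap2 C (k * D) (k\<^sup>2 * E)"
  have E: "C + k\<^sup>2 * E \<ge> 0" for k
    using C \<open>E \<ge> 0\<close> by simp
  \<comment> \<open>Trace and determinant are nonnegative, hence so is the smaller
    eigenvalue.\<close>
  have le: "?g k \<le> ?m k" for k
    unfolding gap2_def
  proof (rule real_le_lsqrt)
    have "k\<^sup>2 * D\<^sup>2 \<le> k\<^sup>2 * (C * E)"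
      using det by (intro mult_left_mono) simp_all
    then show "((C - k\<^sup>2 * E) / 2)\<^sup>2 + (k * D)\<^sup>2 \<le> ((C + k\<^sup>2 * E) / 2)\<^sup>2"
      by (simp add: power2_eq_square algebra_simps add_divide_distrib diff_divide_distrib)
  qed (use E[of k] in simp_all)
  have g: "(?g \<longlongrightarrow> C / 2) (at_right 0)"
  proof -
    have "(?g \<longlongrightarrow> sqrt (((C - 0\<^sup>2 * E) / 2)\<^sup>2 + (0 * D)\<^sup>2)) (at_right 0)"
      unfolding gap2_def by (intro tendsto_intros) simp_all
    then show ?thesis
      using C by (simp add: real_sqrt_abs)
  qed
  have m: "(?m \<longlongrightarrow> C / 2) (at_right 0)"
  proof -
    have "(?m \<longlongrightarrow> (C + 0\<^sup>2 * E) / 2) (at_right 0)"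
      by (intro tendsto_intros) simp_all
    then show ?thesis by simp
  qed
  have "((\<lambda>k. (?m k + ?g k) powr s + (?m k - ?g k) powr s) \<longlongrightarrow>
      (C / 2 + C / 2) powr s + (C / 2 - C / 2) powr s) (at_right 0)"
  \<comment> \<open>A base may tend to 0; there \<open>tendsto_powr'\<close> asks for a positive
    exponent and eventually nonnegative bases.\<close>
  proof (intro tendsto_add tendsto_powr' tendsto_diff g m tendsto_const)
    have "?g k \<ge> 0" for k
      by (simp add: gap2_def)
    then have "?m k + ?g k \<ge> 0" for k
      using E[of k] by (simp add: add_nonneg_nonneg)
    then show "C / 2 + C / 2 \<noteq> 0 \<or> 0 < s \<and> (\<forall>\<^sub>F k in at_right 0. 0 \<le> ?m k + ?g k)"
      using \<open>s > 0\<close> by (intro disjI2 conjI always_eventually allI)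
    show "C / 2 - C / 2 \<noteq> 0 \<or> 0 < s \<and> (\<forall>\<^sub>F k in at_right 0. 0 \<le> ?m k - ?g k)"
      using \<open>s > 0\<close> le by (intro disjI2 conjI always_eventually allI) simp_all
  qed
  moreover have "2 * ((x + y) / 2) = x + y" for x y :: real
    by simp
  ultimately show ?thesis
    unfolding mean2_def by (simp only:) simp
qed

lemma Lambda_sym2_tendsto:
  assumes "s > 0" and "\<bar>t\<bar> < 1"
  shows "((\<lambda>k. Lambda r s (sym2 1 0 k) (sym2 1 t 1) (sym2 a h b)) \<longlongrightarrow>
          corner r t a h b powr s) (at_right 0)"
proof -
  obtain p q w where A: "matrix_powr (sym2 a h b) r = sym2 p q w"
    and c: "corner r t a h b = p\<^sup>2 + 2 * t * p * q + q\<^sup>2"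
    unfolding matrix_powr_def matrix_fun_sym2 corner_def Let_def by blast
  have t: "t\<^sup>2 < 1"
    using \<open>\<bar>t\<bar> < 1\<close> by (simp add: abs_square_less_1)
  have form: "x\<^sup>2 + 2 * t * x * y + y\<^sup>2 = (x + t * y)\<^sup>2 + (1 - t\<^sup>2) * y\<^sup>2" for x y
    by (simp add: power2_eq_square algebra_simps)
  have "x\<^sup>2 + 2 * t * x * y + y\<^sup>2 \<ge> 0" for x y
    unfolding form using t by simp
  \<comment> \<open>Cauchy-Schwarz for the form of M: the difference of the two sides is the
    determinant of the Gram matrix, that is, det M times the square of the determinant of the power
    of A.\<close>
  moreover have "(p * q + t * (p * w + q\<^sup>2) + q * w)\<^sup>2 \<le>
      (p\<^sup>2 + 2 * t * p * q + q\<^sup>2) * (q\<^sup>2 + 2 * t * q * w + w\<^sup>2)"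
  proof -
    have "(p\<^sup>2 + 2 * t * p * q + q\<^sup>2) * (q\<^sup>2 + 2 * t * q * w + w\<^sup>2)
        - (p * q + t * (p * w + q\<^sup>2) + q * w)\<^sup>2 = (1 - t\<^sup>2) * (p * w - q\<^sup>2)\<^sup>2"
      by (simp add: power2_eq_square algebra_simps)
    moreover have "\<dots> \<ge> 0"
      using t by simp
    ultimately show ?thesis by linarith
  qed
  ultimately show ?thesis
    using tendsto_mean2_rank_one[OF \<open>s > 0\<close>]
    by (simp add: Lambda_def A sym2_sandwich c)
       (simp add: matrix_powr_def matrix_fun_sym2 trace_sym2)
qed

section \<open>First-order behaviour at diagonal matrices\<close>

lemma gap2_diagonal: "b < 1 \<Longrightarrow> gap2 1 0 b = (1 - b) / 2"
  by (simp add: gap2_def)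

lemma mean2_diagonal: "b < 1 \<Longrightarrow> mean2 f 1 0 b = (f 1 + f b) / 2"
  by (simp add: mean2_def gap2_diagonal add_divide_distrib diff_divide_distrib)

lemma slope2_diagonal: "b < 1 \<Longrightarrow> slope2 f 1 0 b = (f 1 - f b) / (1 - b)"
  by (simp add: slope2_def gap2_diagonal add_divide_distrib diff_divide_distrib)

text \<open>The eigenvalues depend on \<open>h\<close> only through \<open>h\<^sup>2\<close>, and
  \<open>b < 1\<close> keeps the square root away from its singularity at 0.\<close>

lemma DERIV_slope_mean2_diagonal:
  assumes "b < 1" and f: "(f has_real_derivative \<alpha>) (at 1)" "(f has_real_derivative \<beta>) (at b)"
  shows "((\<lambda>h. mean2 f 1 h b) has_real_derivative 0) (at 0)"
    and "((\<lambda>h. slope2 f 1 h b) has_real_derivative 0) (at 0)"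
proof -
  note g0 = gap2_diagonal[OF \<open>b < 1\<close>]
  have g: "((\<lambda>h. gap2 1 h b) has_real_derivative 0) (at 0)"
    unfolding gap2_def using \<open>b < 1\<close>
    by (auto intro!: derivative_eq_intros)
  have pos: "(1 + b) / 2 + gap2 1 0 b = 1" and neg: "(1 + b) / 2 - gap2 1 0 b = b"
    by (simp_all add: g0 field_simps)
  have gp: "((\<lambda>h. (1 + b) / 2 + gap2 1 h b) has_real_derivative 0) (at 0)"
    and gm: "((\<lambda>h. (1 + b) / 2 - gap2 1 h b) has_real_derivative 0) (at 0)"
    using DERIV_add[OF DERIV_const g] DERIV_diff[OF DERIV_const g] by simp_all
  have fp: "((\<lambda>h. f ((1 + b) / 2 + gap2 1 h b)) has_real_derivative 0) (at 0)"
    using DERIV_chain2[of f, OF _ gp] f by (simp add: pos)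
  have fm: "((\<lambda>h. f ((1 + b) / 2 - gap2 1 h b)) has_real_derivative 0) (at 0)"
    using DERIV_chain2[of f, OF _ gm] f by (simp add: neg)
  show "((\<lambda>h. mean2 f 1 h b) has_real_derivative 0) (at 0)"
    unfolding mean2_def by (rule derivative_eq_intros fp fm refl | simp)+
  show "((\<lambda>h. slope2 f 1 h b) has_real_derivative 0) (at 0)"
    unfolding slope2_def using \<open>b < 1\<close>
    by (auto intro!: derivative_eq_intros fp fm g simp: g0)
qed

lemma corner_diagonal:
  assumes "b < 1"
  shows "corner r t 1 0 b = 1"
proof -
  have "(1 + y) / 2 + (1 - y) / 2 = 1" for y :: real
    by (simp add: field_simps)
  then show ?thesis
    by (simp add: corner_def Let_def mean2_diagonal slope2_diagonal assms)
qed

text \<open>To first order in \<open>h\<close> the first column of the power is 1 over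
  \<open>h\<close> times the divided difference of \<open>x powr r\<close> between \<open>b\<close>
  and 1. Only the mixed term of the quadratic form feels this.\<close>

lemma DERIV_corner_powr:
  assumes "0 < b" "b < 1"
  shows "((\<lambda>h. corner r t 1 h b powr s) has_real_derivative
          2 * t * s * ((1 - b powr r) / (1 - b))) (at 0)"
proof -
  let ?f = "\<lambda>x :: real. x powr r"
  have f: "(?f has_real_derivative r * 1 powr (r - 1)) (at 1)"
    "(?f has_real_derivative r * b powr (r - 1)) (at b)"
    using has_real_derivative_powr[of 1 r] has_real_derivative_powr[of b r] \<open>0 < b\<close> by simp_all
  note D = DERIV_slope_mean2_diagonal[OF \<open>b < 1\<close> f]
  note s0 = slope2_diagonal[OF \<open>b < 1\<close>, of ?f] and m0 = mean2_diagonal[OF \<open>b < 1\<close>, of ?f]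
  have u0: "mean2 ?f 1 0 b + slope2 ?f 1 0 b * (1 - b) / 2 = 1"
    unfolding s0 m0 using \<open>b < 1\<close> by (simp add: field_simps)
  have u: "((\<lambda>h. mean2 ?f 1 h b + slope2 ?f 1 h b * (1 - b) / 2) has_real_derivative 0) (at 0)"
    by (rule derivative_eq_intros D refl | simp)+
  have v: "((\<lambda>h. slope2 ?f 1 h b * h) has_real_derivative (1 - b powr r) / (1 - b)) (at 0)"
    by (rule derivative_eq_intros D refl | simp add: s0)+
  have c: "((\<lambda>h. corner r t 1 h b) has_real_derivative 2 * t * ((1 - b powr r) / (1 - b))) (at 0)"
    unfolding corner_def Let_def by (rule derivative_eq_intros u v refl | simp add: u0)+
  have c0: "corner r t 1 0 b = 1"
    using \<open>b < 1\<close> by (rule corner_diagonal)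
  have "((\<lambda>h. corner r t 1 h b powr s) has_real_derivative
      s * corner r t 1 0 b powr (s - 1) * (2 * t * ((1 - b powr r) / (1 - b)))) (at 0)"
    by (rule has_real_derivative_powr[THEN DERIV_chain2, OF _ c]) (simp add: c0)
  then show ?thesis
    by (simp add: c0 mult_ac)
qed

text \<open>Since 1/4 is the square of 1/2, equality is a quadratic equation in
  \<open>x = (1/2) powr r\<close>. Its roots 1 and 1/2 correspond to the excluded exponents 0 and
  1.\<close>

lemma slope_quarter_neq_half:
  fixes r :: real
  assumes "r \<noteq> 0" "r \<noteq> 1"
  shows "(1 - (1/4) powr r) / (1 - 1/4) \<noteq> (1 - (1/2) powr r) / (1 - 1/2)"
proof
  define x :: real where "x = (1/2) powr r"
  have q: "(1/4 :: real) powr r = x * x"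
    by (simp add: x_def flip: powr_mult)
  assume "(1 - (1/4) powr r) / (1 - 1/4) = (1 - (1/2) powr r) / (1 - 1/2)"
  then have "(1 - x) * (x - 1/2) = 0"
    unfolding q x_def[symmetric] by (simp add: field_simps)
  then have "(1/2 :: real) powr r = 1 \<or> (1/2 :: real) powr r = 1/2"
    by (auto simp: x_def)
  then show False
    using assms powr_inj[of "1/2" r 0] powr_inj[of "1/2" r 1] by auto
qed

section \<open>Violating the midpoint inequalities\<close>

lemma DERIV_nonzero_both_signs:
  fixes D :: "real \<Rightarrow> real"
  assumes D: "(D has_real_derivative l) (at 0)" and "l \<noteq> 0" and "e > 0"
  obtains x y where "\<bar>x\<bar> < e" "D x < D 0" "\<bar>y\<bar> < e" "D y > D 0"
proof (cases "l > 0")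
  case True
  obtain d1 where "d1 > 0" "\<And>h. h > 0 \<Longrightarrow> h < d1 \<Longrightarrow> D 0 < D (0 + h)"
    using DERIV_pos_inc_right[OF D True] by blast
  moreover obtain d2 where "d2 > 0" "\<And>h. h > 0 \<Longrightarrow> h < d2 \<Longrightarrow> D (0 - h) < D 0"
    using DERIV_pos_inc_left[OF D True] by blast
  ultimately show ?thesis
    using \<open>e > 0\<close> by (intro that[of "- (min e d2 / 2)" "min e d1 / 2"]) auto
next
  case False
  then have neg: "l < 0" using \<open>l \<noteq> 0\<close> by simp
  obtain d1 where "d1 > 0" "\<And>h. h > 0 \<Longrightarrow> h < d1 \<Longrightarrow> D 0 > D (0 + h)"
    using DERIV_neg_dec_right[OF D neg] by blast
  moreover obtain d2 where "d2 > 0" "\<And>h. h > 0 \<Longrightarrow> h < d2 \<Longrightarrow> D (0 - h) > D 0"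
    using DERIV_neg_dec_left[OF D neg] by blast
  ultimately show ?thesis
    using \<open>e > 0\<close> by (intro that[of "min e d1 / 2" "- (min e d2 / 2)"]) auto
qed

lemma convex_on_posdef_midpoint:
  fixes F :: "complex ^ 2 ^ 2 \<Rightarrow> real"
  assumes F: "convex_on {A. posdef A} F" and "\<bar>x\<bar> < 1/2"
  shows "2 * F (sym2 1 0 (3/8)) \<le> F (sym2 1 x (1/4)) + F (sym2 1 (- x) (1/2))"
proof -
  \<comment> \<open>1/4 is the smaller of the two products of diagonal entries, so one bound makes
    both endpoints positive definite.\<close>
  have "x\<^sup>2 < 1/4"
    using abs_le_square_iff[of "1/2" x] \<open>\<bar>x\<bar> < 1/2\<close> by (simp add: power2_eq_square not_le)
  then have "posdef (sym2 1 x (1/4))" "posdef (sym2 1 (- x) (1/2))"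
    by (simp_all add: posdef_sym2)
  moreover have "(1/2) *\<^sub>R sym2 1 x (1/4) + (1/2) *\<^sub>R sym2 1 (- x) (1/2) = sym2 1 0 (3/8)"
    by (simp add: vec_eq_iff forall_2 complex_eq_iff)
  ultimately show ?thesis
    using convex_onD[OF F, of "1/2" "sym2 1 x (1/4)" "sym2 1 (- x) (1/2)"] by simp
qed

lemma Lambda_eventually_neither:
  assumes "r \<noteq> 0" "r \<noteq> 1" "s > 0" "t \<noteq> 0" "\<bar>t\<bar> < 1"
  shows "\<forall>\<^sub>F k in at_right 0.
    \<not> concave_on {A. posdef A} (Lambda r s (sym2 1 0 k) (sym2 1 t 1)) \<and>
    \<not> convex_on {A. posdef A} (Lambda r s (sym2 1 0 k) (sym2 1 t 1))"
proof -
  let ?F = "\<lambda>b h. corner r t 1 h b powr s"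
  let ?L = "\<lambda>k b h. Lambda r s (sym2 1 0 k) (sym2 1 t 1) (sym2 1 h b)"
  define q where "q b = (1 - b powr r) / (1 - b)" for b :: real
  define D where "D x = ?F (1/4) x + ?F (1/2) (- x)" for x
  define Lk where "Lk k x = ?L k (1/4) x + ?L k (1/2) (- x) - 2 * ?L k (3/8) 0" for k x
  have F0: "?F b 0 = 1" if "b < 1" for b
    using that by (simp add: corner_diagonal)
  have F': "(?F b has_real_derivative 2 * t * s * q b) (at 0)" if "0 < b" "b < 1" for b
    unfolding q_def using that by (rule DERIV_corner_powr)
  have "(D has_real_derivative 2 * t * s * q (1/4) + - (2 * t * s * q (1/2))) (at 0)"
    unfolding D_def using F'[of "1/4"] F'[of "1/2"] DERIV_mirror[where f = "?F (1/2)" and x = 0]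
    by (intro DERIV_add) simp_all
  moreover have "2 * t * s * q (1/4) + - (2 * t * s * q (1/2)) \<noteq> 0"
    using slope_quarter_neq_half[of r] assms by (simp add: q_def)
  ultimately obtain x y where x: "\<bar>x\<bar> < 1/2" "D x < D 0" and y: "\<bar>y\<bar> < 1/2" "D y > D 0"
    by (rule DERIV_nonzero_both_signs[where e = "1/2"]) simp_all
  \<comment> \<open>The limit function is 1 at every diagonal matrix involved, so the midpoint term
    tends to 2, which is also \<open>D 0\<close>.\<close>
  have lim: "((\<lambda>k. Lk k z) \<longlongrightarrow> D z - D 0) (at_right 0)" for z
  proof -
    have "((\<lambda>k. Lk k z) \<longlongrightarrow> ?F (1/4) z + ?F (1/2) (- z) - 2 * ?F (3/8) 0) (at_right 0)"
      unfolding Lk_def by (intro tendsto_intros Lambda_sym2_tendsto assms)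
    then show ?thesis by (simp add: D_def F0 del: powr_eq_one_iff)
  qed
  have "\<forall>\<^sub>F k in at_right 0. Lk k x < 0" "\<forall>\<^sub>F k in at_right 0. Lk k y > 0"
    using order_tendstoD[OF lim] x(2) y(2) by simp_all
  then show ?thesis
  proof eventually_elim
    case (elim k)
    \<comment> \<open>The point \<open>x\<close> refutes convexity. The point \<open>y\<close>
      refutes concavity, by the same midpoint inequality applied to the negated function.\<close>
    show ?case
      using convex_on_posdef_midpoint[OF _ x(1), of "Lambda r s (sym2 1 0 k) (sym2 1 t 1)"]
        convex_on_posdef_midpoint[OF _ y(1), of "\<lambda>A. - Lambda r s (sym2 1 0 k) (sym2 1 t 1) A"]
        elim
      by (auto simp: Lk_def concave_on_def)
  qed
qed

text \<open>The condition \<open>\<bar>t\<bar> < 1\<close> is exactly positive definiteness of M.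
  The value \<open>t = 0\<close> has to be excluded: for \<open>r = 1/2\<close> and
  \<open>s = 1\<close> the function is then the trace of \<open>K\<^sup>* A K\<close>, which is
  linear in A.\<close>

theorem theorem2p2:
  fixes r s \<epsilon> :: real
  assumes "r \<noteq> 0" and "r \<noteq> 1" and "s > 0" and "\<epsilon> > 0"
  shows "(\<exists>K M :: complex ^ 2 ^ 2. invertible K \<and> posdef M \<and> op_norm (M - mat 1) < \<epsilon> \<and>
           \<not> concave_on {A. posdef A} (Lambda r s K M) \<and>
           \<not> convex_on {A. posdef A} (Lambda r s K M)) \<and>
         (\<forall>t :: real. t \<noteq> 0 \<and> \<bar>t\<bar> < \<epsilon> \<and> \<bar>t\<bar> < 1 \<longrightarrow>
           (\<exists>k0 > 0. \<forall>k :: real. 0 < k \<and> k < k0 \<longrightarrow>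
             (let K = vector [vector [1, 0], vector [0, complex_of_real k]] :: complex ^ 2 ^ 2;
                  M = vector [vector [1, complex_of_real t], vector [complex_of_real t, 1]]
                    :: complex ^ 2 ^ 2
              in invertible K \<and> posdef M \<and> op_norm (M - mat 1) < \<epsilon> \<and>
                 \<not> concave_on {A. posdef A} (Lambda r s K M) \<and>
                 \<not> convex_on {A. posdef A} (Lambda r s K M))))"
proof -
  have main: "\<exists>k0 > 0. \<forall>k :: real. 0 < k \<and> k < k0 \<longrightarrow>
      invertible (sym2 1 0 k) \<and> posdef (sym2 1 t 1) \<and> op_norm (sym2 1 t 1 - mat 1) < \<epsilon> \<and>
      \<not> concave_on {A. posdef A} (Lambda r s (sym2 1 0 k) (sym2 1 t 1)) \<and>
      \<not> convex_on {A. posdef A} (Lambda r s (sym2 1 0 k) (sym2 1 t 1))"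
    if t: "t \<noteq> 0" "\<bar>t\<bar> < \<epsilon>" "\<bar>t\<bar> < 1" for t
  proof -
    have "posdef (sym2 1 t 1)"
      using t by (intro posdef_sym2) (simp_all add: abs_square_less_1)
    moreover have "op_norm (sym2 1 t 1 - mat 1) < \<epsilon>"
      using op_norm_off_diagonal[of t] t by linarith
    moreover have "invertible (sym2 1 0 k)" if "k > 0" for k
      using that by (simp add: invertible_sym2)
    ultimately show ?thesis
      using Lambda_eventually_neither[of r s t] assms t
      by (auto simp: eventually_at_right_field)
  qed
  show ?thesis
  proof (intro conjI allI impI)
    define t where "t = min \<epsilon> 1 / 2"
    have "t \<noteq> 0" "\<bar>t\<bar> < \<epsilon>" "\<bar>t\<bar> < 1"
      using \<open>\<epsilon> > 0\<close> by (auto simp: t_def)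
    from main[OF this] obtain k0 where "k0 > 0" and k0: "\<forall>k. 0 < k \<and> k < k0 \<longrightarrow>
      invertible (sym2 1 0 k) \<and> posdef (sym2 1 t 1) \<and> op_norm (sym2 1 t 1 - mat 1) < \<epsilon> \<and>
      \<not> concave_on {A. posdef A} (Lambda r s (sym2 1 0 k) (sym2 1 t 1)) \<and>
      \<not> convex_on {A. posdef A} (Lambda r s (sym2 1 0 k) (sym2 1 t 1))"
      by blast
    then show "\<exists>K M :: complex ^ 2 ^ 2. invertible K \<and> posdef M \<and> op_norm (M - mat 1) < \<epsilon> \<and>
           \<not> concave_on {A. posdef A} (Lambda r s K M) \<and>
           \<not> convex_on {A. posdef A} (Lambda r s K M)"
      by (metis field_lbound_gt_zero)
  next
    fix t :: real
    assume "t \<noteq> 0 \<and> \<bar>t\<bar> < \<epsilon> \<and> \<bar>t\<bar> < 1"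
    then show "\<exists>k0 > 0. \<forall>k :: real. 0 < k \<and> k < k0 \<longrightarrow>
             (let K = vector [vector [1, 0], vector [0, complex_of_real k]] :: complex ^ 2 ^ 2;
                  M = vector [vector [1, complex_of_real t], vector [complex_of_real t, 1]]
                    :: complex ^ 2 ^ 2
              in invertible K \<and> posdef M \<and> op_norm (M - mat 1) < \<epsilon> \<and>
                 \<not> concave_on {A. posdef A} (Lambda r s K M) \<and>
                 \<not> convex_on {A. posdef A} (Lambda r s K M))"
      using main[of t] unfolding sym2_def Let_def of_real_1 of_real_0 by blast
  qed
qed

end
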